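(* Every countably infinite ${\le}5$-set-homogeneous 4-hypergraph has an automorphism group which is 2-transitive on its vertex set.
   Context: A 4-hypergraph is a pair $(M,E)$ with $M$ countable and $E$ a set of 4-element subsets of $M$ (edges). It is ${\le}5$-set-homogeneous if for each $s\le 5$, whenever $U,V\subseteq M$ with $|U|=|V|=s$ carry isomorphic induced subhypergraphs there is $g\in\mathrm{Aut}(M,E)$ with $U^g=V$. A permutation group is 2-transitive if transitive on ordered pairs of distinct points. *)

theory Defs
  imports Main "HOL-Library.Countable_Set"
begin

definition hypergraph4 :: "'a set \<Rightarrow> 'a set set \<Rightarrow> bool" where
  "hypergraph4 M E \<longleftrightarrow> (\<forall>e\<in>E. e \<subseteq> M \<and> card e = 4)"

definition hg_aut :: "'a set \<Rightarrow> 'a set set \<Rightarrow> ('a \<Rightarrow> 'a) \<Rightarrow> bool" where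
  "hg_aut M E g \<longleftrightarrow> bij_betw g M M \<and>
     (\<forall>e. e \<subseteq> M \<longrightarrow> (e \<in> E \<longleftrightarrow> g ` e \<in> E))"

definition induced_iso :: "'a set set \<Rightarrow> 'a set \<Rightarrow> 'a set \<Rightarrow> ('a \<Rightarrow> 'a) \<Rightarrow> bool" where
  "induced_iso E U V f \<longleftrightarrow> bij_betw f U V \<and>
     (\<forall>e. e \<subseteq> U \<longrightarrow> (e \<in> E \<longleftrightarrow> f ` e \<in> E))"

definition set_homogeneous_upto :: "nat \<Rightarrow> 'a set \<Rightarrow> 'a set set \<Rightarrow> bool" where
  "set_homogeneous_upto k M E \<longleftrightarrow>
     (\<forall>s\<le>k. \<forall>U V. U \<subseteq> M \<and> V \<subseteq> M \<and> finite U \<and> finite V \<and> card U = s \<and> card V = s \<and>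
        (\<exists>f. induced_iso E U V f) \<longrightarrow> (\<exists>g. hg_aut M E g \<and> g ` U = V))"

definition aut_two_transitive :: "'a set \<Rightarrow> 'a set set \<Rightarrow> bool" where
  "aut_two_transitive M E \<longleftrightarrow>
     (\<forall>x\<in>M. \<forall>y\<in>M. \<forall>u\<in>M. \<forall>v\<in>M. x \<noteq> y \<and> u \<noteq> v \<longrightarrow>
        (\<exists>g. hg_aut M E g \<and> g x = u \<and> g y = v))"

end

theory Submission
  imports Defs "HOL-Combinatorics.Transposition"
begin

text \<open>All sets of at most three points are conjugate under the automorphism group \<open>G\<close>. If \<open>G\<close> is
  not 2-transitive, the orbits on ordered pairs therefore form an invariant tournament, and since all
  triples are conjugate and some triple is transitive, this tournament is a linear order. Hence an
  automorphism mapping one finite set onto another does so monotonically. As the isomorphism type of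
  a 5-set is the number of its edges, for each number of edges at most one pattern of edges along
  an increasing 5-chain occurs.

  Every edge and every non-edge contains a conjugate of every triple. So any triple extends in each
  of its four gaps to an edge and to a non-edge, and extending it in two gaps at once shows that the
  patterns that occur take all four values at any two non-adjacent positions. Moreover two patterns
  that agree on a common 4-set amalgamate to a 6-chain, all of whose 5-subchains have a pattern that
  occurs. A finite search, over at most one pattern for each number of edges from 1 to 4, shows that
  these conditions are incompatible.\<close>

section \<open>Patterns of five-element chains\<close>

text \<open>A pattern records, for each of the five positions in an increasing chain, whether deleting
  the point in that position leaves an edge.\<close>

type_synonym pattern = "bool \<times> bool \<times> bool \<times> bool \<times> bool"

definition weight :: "pattern \<Rightarrow> nat" where
  "weight = (\<lambda>(a, b, c, d, e). length (filter id [a, b, c, d, e]))"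

definition patterns :: "nat \<Rightarrow> pattern list" where
  "patterns k = filter (\<lambda>p. weight p = k)
     (List.product [True, False] (List.product [True, False] (List.product [True, False]
       (List.product [True, False] [True, False]))))"

text \<open>The empty list covers the case that no pattern of this weight occurs.\<close>

definition selections :: "nat \<Rightarrow> pattern list list" where
  "selections k = [] # map (\<lambda>p. [p]) (patterns k)"

text \<open>The six pairs of non-adjacent positions are each asked to take both pairs of unequal
  values. A pattern with unequal values is not constant, so its weight lies between 1 and 4.\<close>

definition separating :: "pattern list \<Rightarrow> bool" where
  "separating L \<longleftrightarrow>
    list_ex (\<lambda>(a, b, c, d, e). a \<and> \<not> c) L \<and> list_ex (\<lambda>(a, b, c, d, e). \<not> a \<and> c) L \<and>
    list_ex (\<lambda>(a, b, c, d, e). a \<and> \<not> d) L \<and> list_ex (\<lambda>(a, b, c, d, e). \<not> a \<and> d) L \<and>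
    list_ex (\<lambda>(a, b, c, d, e). a \<and> \<not> e) L \<and> list_ex (\<lambda>(a, b, c, d, e). \<not> a \<and> e) L \<and>
    list_ex (\<lambda>(a, b, c, d, e). b \<and> \<not> d) L \<and> list_ex (\<lambda>(a, b, c, d, e). \<not> b \<and> d) L \<and>
    list_ex (\<lambda>(a, b, c, d, e). b \<and> \<not> e) L \<and> list_ex (\<lambda>(a, b, c, d, e). \<not> b \<and> e) L \<and>
    list_ex (\<lambda>(a, b, c, d, e). c \<and> \<not> e) L \<and> list_ex (\<lambda>(a, b, c, d, e). \<not> c \<and> e) L"

text \<open>In a six-element chain let \<open>cij\<close> say whether deleting the points in positions \<open>i < j\<close>
  leaves an edge. If \<open>p\<close> is the pattern obtained by deleting position 3 and \<open>q\<close> the one obtained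
  by deleting position 1, then \<open>p\<close> and \<open>q\<close> determine all \<open>cij\<close> except those with
  \<open>i, j \<in> {2, 4, 5, 6}\<close>, and the four nested clauses are the patterns obtained by deleting
  positions 2, 4, 5, 6. The two constant patterns are always admitted.\<close>

definition amalgamating :: "pattern list \<Rightarrow> bool" where
  "amalgamating L \<longleftrightarrow> list_all (\<lambda>(p1, p2, p3, p4, p5). list_all (\<lambda>(q1, q2, q3, q4, q5).
     q2 = p1 \<longrightarrow> (let K = (False, False, False, False, False) # (True, True, True, True, True) # L in
       list_ex (\<lambda>(r1, r2, c24, c25, c26). r1 = q1 \<and> r2 = p2 \<and>
       list_ex (\<lambda>(r1, r2, r3, c45, c46). r1 = q3 \<and> r2 = c24 \<and> r3 = p3 \<and>
       list_ex (\<lambda>(r1, r2, r3, r4, c56). r1 = q4 \<and> r2 = c25 \<and> r3 = p4 \<and> r4 = c45 \<and>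
       list_ex (\<lambda>r. r = (q5, c26, p5, c46, c56)) K) K) K) K)) L) L"

text \<open>Exhaustive evaluation: there are 5, 10, 10 and 5 patterns of weights 1, 2, 3 and 4,
  hence 6 * 11 * 11 * 6 = 4356 selections.\<close>

lemma no_separating_amalgamating_selection:
  "list_all (\<lambda>l1. list_all (\<lambda>l2. list_all (\<lambda>l3. list_all (\<lambda>l4.
     \<not> (separating (l1 @ l2 @ l3 @ l4) \<and> amalgamating (l1 @ l2 @ l3 @ l4)))
     (selections 4)) (selections 3)) (selections 2)) (selections 1)"
  by code_simp

text \<open>The non-constant part of \<open>R\<close> is one of the selections searched above.
  Admitting both constant patterns only weakens \<open>amalgamating\<close>, so the search applies
  whichever of them satisfy \<open>R\<close>.\<close>

lemma pattern_class_inconsistent: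
  fixes R :: "pattern \<Rightarrow> bool"
  assumes uniq: "\<And>p q. \<lbrakk>R p; R q; weight p = weight q\<rbrakk> \<Longrightarrow> p = q"
    and sep13: "\<And>x y. \<exists>b d e. R (x, b, y, d, e)"
    and sep14: "\<And>x y. \<exists>b c e. R (x, b, c, y, e)"
    and sep15: "\<And>x y. \<exists>b c d. R (x, b, c, d, y)"
    and sep24: "\<And>x y. \<exists>a c e. R (a, x, c, y, e)"
    and sep25: "\<And>x y. \<exists>a c d. R (a, x, c, d, y)"
    and sep35: "\<And>x y. \<exists>a b d. R (a, b, x, d, y)"
    and amalg: "\<And>p1 p2 p3 p4 p5 q1 q3 q4 q5.
      \<lbrakk>R (p1, p2, p3, p4, p5); R (q1, p1, q3, q4, q5)\<rbrakk> \<Longrightarrow>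
      \<exists>c24 c25 c26 c45 c46 c56.
        R (q1, p2, c24, c25, c26) \<and> R (q3, c24, p3, c45, c46) \<and>
        R (q4, c25, p4, c45, c56) \<and> R (q5, c26, p5, c46, c56)"
  shows False
proof -
  \<comment> \<open>By \<open>uniq\<close> the choice is forced: \<open>sel k\<close> lists all
    patterns of weight \<open>k\<close> in \<open>R\<close>.\<close>
  define sel where "sel k = (if \<exists>p. R p \<and> weight p = k then [SOME p. R p \<and> weight p = k] else [])" for k
  have sel_iff: "p \<in> set (sel k) \<longleftrightarrow> R p \<and> weight p = k" for p k
  proof (cases "\<exists>p. R p \<and> weight p = k")
    case True
    then obtain q where q: "R q" "weight q = k" by blast
    have "(SOME p. R p \<and> weight p = k) = q"
    proof (rule some_equality)
      show "R q \<and> weight q = k"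
        using q by blast
      show "p' = q" if "R p' \<and> weight p' = k" for p'
        using that q by (intro uniq) simp_all
    qed
    then have "set (sel k) = {q}"
      unfolding sel_def if_P[OF True] by simp
    then show ?thesis
      using q uniq by (metis singleton_iff)
  next
    case False
    then have "sel k = []"
      unfolding sel_def by (rule if_not_P)
    then have "p \<notin> set (sel k)"
      by simp
    with False show ?thesis
      by blast
  qed
  have "set [True, False] = UNIV"
    by auto
  then have patterns: "set (patterns k) = {p. weight p = k}" for k
    unfolding patterns_def set_filter set_product by simp
  have sel_in: "sel k \<in> set (selections k)" for k
  proof (cases "\<exists>p. R p \<and> weight p = k")
    case True
    then have "weight (SOME p. R p \<and> weight p = k) = k"
      by (rule someI_ex[THEN conjunct2])
    then show ?thesis
      unfolding sel_def if_P[OF True] selections_def by (simp add: patterns)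
  next
    case False
    then show ?thesis
      unfolding sel_def if_not_P[OF False] selections_def by simp
  qed
  define L where "L = sel 1 @ sel 2 @ sel 3 @ sel 4"
  have L_iff: "p \<in> set L \<longleftrightarrow> R p \<and> weight p \<in> {1, 2, 3, 4}" for p
    by (auto simp: L_def sel_iff)
  \<comment> \<open>Weights 0 and 5 belong to the constant patterns alone.\<close>
  have mixed: "(a, b, c, d, e) \<in> set L"
    if "R (a, b, c, d, e)" "\<not> (a \<and> b \<and> c \<and> d \<and> e)" "a \<or> b \<or> c \<or> d \<or> e" for a b c d e
    using that by (auto simp: L_iff weight_def)
  have mixed_ex: "\<exists>p\<in>set L. P p"
    if "R (a, b, c, d, e)" "\<not> (a \<and> b \<and> c \<and> d \<and> e)" "a \<or> b \<or> c \<or> d \<or> e" "P (a, b, c, d, e)"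
    for a b c d e P
    using mixed[OF that(1-3)] that(4) by (rule bexI[rotated])
  have "separating L"
    unfolding separating_def list_ex_iff
  proof (intro conjI)
    show "\<exists>p\<in>set L. case p of (a, b, c, d, e) \<Rightarrow> a \<and> \<not> c"
      using sep13[of True False] by (elim exE) (rule mixed_ex, assumption, simp_all)
    show "\<exists>p\<in>set L. case p of (a, b, c, d, e) \<Rightarrow> \<not> a \<and> c"
      using sep13[of False True] by (elim exE) (rule mixed_ex, assumption, simp_all)
    show "\<exists>p\<in>set L. case p of (a, b, c, d, e) \<Rightarrow> a \<and> \<not> d"
      using sep14[of True False] by (elim exE) (rule mixed_ex, assumption, simp_all)
    show "\<exists>p\<in>set L. case p of (a, b, c, d, e) \<Rightarrow> \<not> a \<and> d"
      using sep14[of False True] by (elim exE) (rule mixed_ex, assumption, simp_all)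
    show "\<exists>p\<in>set L. case p of (a, b, c, d, e) \<Rightarrow> a \<and> \<not> e"
      using sep15[of True False] by (elim exE) (rule mixed_ex, assumption, simp_all)
    show "\<exists>p\<in>set L. case p of (a, b, c, d, e) \<Rightarrow> \<not> a \<and> e"
      using sep15[of False True] by (elim exE) (rule mixed_ex, assumption, simp_all)
    show "\<exists>p\<in>set L. case p of (a, b, c, d, e) \<Rightarrow> b \<and> \<not> d"
      using sep24[of True False] by (elim exE) (rule mixed_ex, assumption, simp_all)
    show "\<exists>p\<in>set L. case p of (a, b, c, d, e) \<Rightarrow> \<not> b \<and> d"
      using sep24[of False True] by (elim exE) (rule mixed_ex, assumption, simp_all)
    show "\<exists>p\<in>set L. case p of (a, b, c, d, e) \<Rightarrow> b \<and> \<not> e"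
      using sep25[of True False] by (elim exE) (rule mixed_ex, assumption, simp_all)
    show "\<exists>p\<in>set L. case p of (a, b, c, d, e) \<Rightarrow> \<not> b \<and> e"
      using sep25[of False True] by (elim exE) (rule mixed_ex, assumption, simp_all)
    show "\<exists>p\<in>set L. case p of (a, b, c, d, e) \<Rightarrow> c \<and> \<not> e"
      using sep35[of True False] by (elim exE) (rule mixed_ex, assumption, simp_all)
    show "\<exists>p\<in>set L. case p of (a, b, c, d, e) \<Rightarrow> \<not> c \<and> e"
      using sep35[of False True] by (elim exE) (rule mixed_ex, assumption, simp_all)
  qed
  moreover have "amalgamating L"
  proof -
    define K where "K = (False, False, False, False, False) # (True, True, True, True, True) # L"
    have K: "(a, b, c, d, e) \<in> set K" if "R (a, b, c, d, e)" for a b c d e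
      using that mixed[OF that] by (auto simp: K_def)
    have "list_ex (\<lambda>(r1, r2, c24, c25, c26). r1 = q1 \<and> r2 = p2 \<and>
       list_ex (\<lambda>(r1, r2, r3, c45, c46). r1 = q3 \<and> r2 = c24 \<and> r3 = p3 \<and>
       list_ex (\<lambda>(r1, r2, r3, r4, c56). r1 = q4 \<and> r2 = c25 \<and> r3 = p4 \<and> r4 = c45 \<and>
       list_ex (\<lambda>r. r = (q5, c26, p5, c46, c56)) K) K) K) K"
      if "(p1, p2, p3, p4, p5) \<in> set L" "(q1, p1, q3, q4, q5) \<in> set L"
      for p1 p2 p3 p4 p5 q1 q3 q4 q5
    proof -
      have "R (p1, p2, p3, p4, p5)" "R (q1, p1, q3, q4, q5)"
        using that unfolding L_iff by blast+
      from amalg[OF this] obtain c24 c25 c26 c45 c46 c56 where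
        "R (q1, p2, c24, c25, c26)" "R (q3, c24, p3, c45, c46)"
        "R (q4, c25, p4, c45, c56)" "R (q5, c26, p5, c46, c56)"
        by blast
      from this[THEN K] show ?thesis
        unfolding list_ex_iff
        \<comment> \<open>Each witness fixes the entries \<open>cij\<close> to which the clauses
          nested inside it refer.\<close>
        by - (rule bexI[of _ "(q1, p2, c24, c25, c26)"], unfold prod.case,
            intro conjI refl, rule bexI[of _ "(q3, c24, p3, c45, c46)"], unfold prod.case,
            intro conjI refl, rule bexI[of _ "(q4, c25, p4, c45, c56)"], unfold prod.case,
            intro conjI refl, rule bexI[of _ "(q5, c26, p5, c46, c56)"], rule refl, assumption+)
    qed
    then show ?thesis
      unfolding amalgamating_def list_all_iff Let_def K_def[symmetric]
      by (intro ballI case_prodI2 impI) simp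
  qed
  moreover have "\<not> (separating L \<and> amalgamating L)"
    using no_separating_amalgamating_selection[unfolded list_all_iff, THEN bspec, OF sel_in,
        THEN bspec, OF sel_in, THEN bspec, OF sel_in, THEN bspec, OF sel_in]
    unfolding L_def .
  ultimately show False
    by blast
qed

section \<open>Automorphisms\<close>

lemma hg_aut_comp:
  assumes "hg_aut M E g" "hg_aut M E h"
  shows "hg_aut M E (g \<circ> h)"
  unfolding hg_aut_def
proof (intro conjI allI impI)
  show "bij_betw (g \<circ> h) M M"
    using assms by (auto simp: hg_aut_def intro: bij_betw_trans)
  fix e assume e: "e \<subseteq> M"
  then have "h ` e \<subseteq> M"
    using assms(2) by (auto simp: hg_aut_def bij_betw_def)
  then show "e \<in> E \<longleftrightarrow> (g \<circ> h) ` e \<in> E"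
    using assms e unfolding hg_aut_def image_comp[symmetric] by blast
qed

lemma hg_aut_inv_into:
  assumes "hg_aut M E g"
  shows "hg_aut M E (inv_into M g)"
proof -
  have bij: "bij_betw g M M"
    using assms by (simp add: hg_aut_def)
  have "e \<in> E \<longleftrightarrow> inv_into M g ` e \<in> E" if "e \<subseteq> M" for e
  proof -
    have "inv_into M g ` e \<subseteq> M"
      using that bij bij_betw_inv_into[OF bij] by (auto simp: bij_betw_def)
    moreover have "g ` inv_into M g ` e = e"
      using that bij by (simp add: bij_betw_def image_inv_into_cancel)
    ultimately show ?thesis
      using assms unfolding hg_aut_def by metis
  qed
  then show ?thesis
    using bij_betw_inv_into[OF bij] by (simp add: hg_aut_def)
qed

lemma hg_aut_in: "\<lbrakk>hg_aut M E g; x \<in> M\<rbrakk> \<Longrightarrow> g x \<in> M"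
  by (auto simp: hg_aut_def bij_betw_def)

lemma hg_aut_edge: "\<lbrakk>hg_aut M E g; e \<subseteq> M\<rbrakk> \<Longrightarrow> g ` e \<in> E \<longleftrightarrow> e \<in> E"
  by (simp add: hg_aut_def)

text \<open>A bijection preserves cardinality, so sets of any other size are non-edges on both
  sides.\<close>

lemma induced_isoI:
  assumes "hypergraph4 M E" "bij_betw f U V"
    and "\<And>e. \<lbrakk>e \<subseteq> U; card e = 4\<rbrakk> \<Longrightarrow> e \<in> E \<longleftrightarrow> f ` e \<in> E"
  shows "induced_iso E U V f"
  unfolding induced_iso_def
proof (intro conjI allI impI)
  fix e assume e: "e \<subseteq> U"
  then have "card (f ` e) = card e"
    using assms(2) by (auto simp: bij_betw_def intro: card_image inj_on_subset)
  then show "e \<in> E \<longleftrightarrow> f ` e \<in> E"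
    using assms(1,3) e by (cases "card e = 4") (auto simp: hypergraph4_def)
qed (fact assms(2))

text \<open>Every permutation of \<open>M\<close> is an automorphism here, and two transpositions
  suffice to move one ordered pair to another. This later supplies both an edge and a
  non-edge.\<close>

lemma trivial_hypergraph_two_transitive:
  assumes hyp: "hypergraph4 M E"
    and triv: "\<And>e e'. \<lbrakk>e \<subseteq> M; e' \<subseteq> M; card e = 4; card e' = 4\<rbrakk> \<Longrightarrow> e \<in> E \<longleftrightarrow> e' \<in> E"
  shows "aut_two_transitive M E"
  unfolding aut_two_transitive_def
proof (intro ballI impI)
  fix x y u v assume *: "x \<in> M" "y \<in> M" "u \<in> M" "v \<in> M" "x \<noteq> y \<and> u \<noteq> v"
  \<comment> \<open>After \<open>x\<close> has gone to \<open>u\<close>, the point \<open>y\<close>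
    sits at \<open>y'\<close>. The second transposition fixes \<open>u\<close>, as \<open>u\<close>
    differs from both \<open>y'\<close> and \<open>v\<close>.\<close>
  define y' where "y' = transpose x u y"
  define g where "g = transpose y' v \<circ> transpose x u"
  have transpose: "bij_betw (transpose a b) M M" if "a \<in> M" "b \<in> M" for a b
    by (rule bij_betw_byWitness[where f' = "transpose a b"]) (use that in \<open>auto simp: transpose_def\<close>)
  have "y' \<in> M"
    using * by (auto simp: y'_def transpose_def)
  then have bij: "bij_betw g M M"
    using * unfolding g_def by (intro bij_betw_trans[OF transpose transpose]) auto
  have "induced_iso E M M g"
  proof (rule induced_isoI[OF hyp bij])
    fix e assume e: "e \<subseteq> M" "card e = 4"
    then have "g ` e \<subseteq> M" "card (g ` e) = 4"
      using bij by (auto simp: bij_betw_def card_image inj_on_subset)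
    then show "e \<in> E \<longleftrightarrow> g ` e \<in> E"
      using triv e by blast
  qed
  then have "hg_aut M E g"
    by (simp add: hg_aut_def induced_iso_def)
  moreover have "g x = u" "g y = v"
    using * by (auto simp: g_def y'_def transpose_def)
  ultimately show "\<exists>g. hg_aut M E g \<and> g x = u \<and> g y = v"
    by blast
qed

text \<open>Glues a bijection of the subsets to one of their complements. It will match the points
  whose deletion leaves an edge.\<close>

lemma ex_bij_betw_subset:
  assumes fin: "finite U" "finite V" and card: "card U = card V"
    and sub: "C \<subseteq> U" "D \<subseteq> V" and eq: "card C = card D"
  obtains f where "bij_betw f U V" "\<forall>z\<in>U. f z \<in> D \<longleftrightarrow> z \<in> C"
proof -
  have fin': "finite C" "finite D"
    using sub fin finite_subset by blast+
  obtain f1 where f1: "bij_betw f1 C D"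
    using finite_same_card_bij[OF fin' eq] by blast
  have "card (U - C) = card (V - D)"
    using sub fin' card eq by (simp add: card_Diff_subset)
  then obtain f2 where f2: "bij_betw f2 (U - C) (V - D)"
    using finite_same_card_bij[of "U - C" "V - D"] fin by auto
  define f where "f z = (if z \<in> C then f1 z else f2 z)" for z
  have "bij_betw f C D"
    using f1 by (rule bij_betw_cong[THEN iffD1, rotated]) (simp add: f_def)
  moreover have "bij_betw f (U - C) (V - D)"
    using f2 by (rule bij_betw_cong[THEN iffD1, rotated]) (simp add: f_def)
  ultimately have "bij_betw f (C \<union> (U - C)) (D \<union> (V - D))"
    by (rule bij_betw_combine) blast
  then have "bij_betw f U V"
    using sub by (simp only: Un_Diff_cancel Un_absorb1)
  moreover have "\<forall>z\<in>U. f z \<in> D \<longleftrightarrow> z \<in> C"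
    using f1 f2 unfolding f_def bij_betw_def by auto
  ultimately show ?thesis
    by (rule that)
qed

section \<open>Conjugacy of small sets\<close>

lemma set_homogeneousE:
  assumes "set_homogeneous_upto 5 M E" "U \<subseteq> M" "V \<subseteq> M" "finite U" "finite V"
    and "card U = card V" "card V \<le> 5" "induced_iso E U V f"
  obtains g where "hg_aut M E g" "g ` U = V"
proof -
  have "\<exists>g. hg_aut M E g \<and> g ` U = V"
    using assms(1)[unfolded set_homogeneous_upto_def, rule_format, of "card V" U V] assms(2-) by blast
  then show ?thesis
    using that by blast
qed

text \<open>With at most three points there is no 4-subset to respect, so every bijection is an
  induced isomorphism.\<close>

lemma small_sets_conjugate:
  assumes hyp: "hypergraph4 M E" and hom: "set_homogeneous_upto 5 M E"
    and "U \<subseteq> M" "V \<subseteq> M" "finite U" "finite V" "card U = card V" "card V \<le> 3"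
  obtains g where "hg_aut M E g" "g ` U = V"
proof -
  obtain f where f: "bij_betw f U V"
    using assms finite_same_card_bij by blast
  have "induced_iso E U V f"
  proof (rule induced_isoI[OF hyp f])
    fix e assume "e \<subseteq> U" "card e = 4"
    then have False
      using assms card_mono[of U e] by simp
    then show "e \<in> E \<longleftrightarrow> f ` e \<in> E" ..
  qed
  then show ?thesis
  proof (rule set_homogeneousE[OF hom assms(3-7), rotated])
    show "card V \<le> 5"
      using assms(8) by simp
  qed (fact that)
qed

section \<open>Hypergraphs with an invariant linear order\<close>

text \<open>The structure that a counterexample would carry; the goal is to derive
  \<open>False\<close> from these assumptions.\<close>

locale ordered_hypergraph =
  fixes M :: "'a set" and E :: "'a set set" and lt :: "'a \<Rightarrow> 'a \<Rightarrow> bool" (infix "\<sqsubset>" 50)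
  assumes hyp: "hypergraph4 M E"
    and hom: "set_homogeneous_upto 5 M E"
    and edge: "\<exists>e\<subseteq>M. card e = 4 \<and> e \<in> E"
    and nonedge: "\<exists>e\<subseteq>M. card e = 4 \<and> e \<notin> E"
    and lt_irrefl: "x \<in> M \<Longrightarrow> \<not> x \<sqsubset> x"
    and lt_trans: "\<lbrakk>x \<in> M; y \<in> M; z \<in> M; x \<sqsubset> y; y \<sqsubset> z\<rbrakk> \<Longrightarrow> x \<sqsubset> z"
    and lt_total: "\<lbrakk>x \<in> M; y \<in> M; x \<noteq> y\<rbrakk> \<Longrightarrow> x \<sqsubset> y \<or> y \<sqsubset> x"
    and lt_aut: "\<lbrakk>hg_aut M E g; x \<in> M; y \<in> M; x \<sqsubset> y\<rbrakk> \<Longrightarrow> g x \<sqsubset> g y"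
begin

section \<open>Finite chains and the automorphisms between them\<close>

definition chain :: "'a list \<Rightarrow> bool" where
  "chain xs \<longleftrightarrow> set xs \<subseteq> M \<and> sorted_wrt (\<sqsubset>) xs"

lemma chain_simps [simp]:
  "chain []"
  "chain (x # xs) \<longleftrightarrow> x \<in> M \<and> (\<forall>y\<in>set xs. x \<sqsubset> y) \<and> chain xs"
  by (auto simp: chain_def)

lemma chain_distinct: "chain xs \<Longrightarrow> distinct xs"
  by (induction xs) (auto simp: lt_irrefl)

text \<open>The heads are the least elements: if they differed, each would precede the
  other.\<close>

lemma chain_unique: "\<lbrakk>chain xs; chain ys; set xs = set ys\<rbrakk> \<Longrightarrow> xs = ys"
proof (induction xs arbitrary: ys)
  case Nil
  then show ?case by simp
next
  case (Cons x xs)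
  obtain y ys' where ys: "ys = y # ys'"
    using Cons.prems(3) by (cases ys) auto
  have x: "x \<in> M" "\<forall>z\<in>set xs. x \<sqsubset> z" "chain xs" and y: "y \<in> M" "\<forall>z\<in>set ys'. y \<sqsubset> z" "chain ys'"
    using Cons.prems(1,2) by (simp_all add: ys)
  have eq: "insert x (set xs) = insert y (set ys')"
    using Cons.prems(3) by (simp add: ys)
  have "x = y"
  proof (rule ccontr)
    assume "x \<noteq> y"
    then have "x \<in> set ys'" "y \<in> set xs"
      using equalityD1[OF eq] equalityD2[OF eq] by simp_all
    then have "y \<sqsubset> x" "x \<sqsubset> y"
      using x(2) y(2) by simp_all
    then show False
      using lt_trans[OF x(1) y(1) x(1)] lt_irrefl[OF x(1)] by simp
  qed
  have "x \<notin> set xs" "y \<notin> set ys'"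
    using lt_irrefl[OF x(1)] lt_irrefl[OF y(1)] x(2) y(2) by blast+
  then have "set xs = set ys'"
    using eq unfolding \<open>x = y\<close> by (rule insert_ident[THEN iffD1])
  then show ?case
    using Cons.IH[OF x(3) y(3)] \<open>x = y\<close> ys by simp
qed

lemma chain_map_aut: "\<lbrakk>hg_aut M E g; chain xs\<rbrakk> \<Longrightarrow> chain (map g xs)"
proof (induction xs)
  case (Cons x xs)
  have x: "x \<in> M" "set xs \<subseteq> M" "\<forall>y\<in>set xs. x \<sqsubset> y"
    using Cons.prems(2) by (auto simp: chain_def)
  then have "\<forall>y\<in>set xs. g x \<sqsubset> g y"
    using lt_aut[OF Cons.prems(1)] by blast
  then show ?case
    using Cons x(1) by (simp add: hg_aut_in)
qed simp

lemma ex_chain: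
  assumes "finite A" "A \<subseteq> M"
  obtains xs where "chain xs" "set xs = A" "length xs = card A"
proof -
  have "\<exists>xs. chain xs \<and> set xs = A"
    using assms
  proof (induction A rule: finite_induct)
    case empty
    have "chain [] \<and> set [] = {}" by simp
    then show ?case by (rule exI)
  next
    case (insert x A)
    from insert.IH[OF order_trans[OF subset_insertI insert.prems]]
    obtain xs where xs: "chain xs" "set xs = A" by (elim exE conjE)
    define ys where "ys = filter (\<lambda>y. y \<sqsubset> x) xs @ x # filter (\<lambda>y. x \<sqsubset> y) xs"
    have "y \<sqsubset> x \<or> x \<sqsubset> y" if "y \<in> A" for y
      using that insert.hyps insert.prems by (intro lt_total) auto
    then have "set ys = insert x A"
      using xs(2) by (auto simp: ys_def)
    moreover have "chain ys"
      unfolding chain_def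
    proof
      show "set ys \<subseteq> M"
        using \<open>set ys = insert x A\<close> insert.prems by simp
      show "sorted_wrt (\<sqsubset>) ys"
        unfolding ys_def sorted_wrt_append
      proof (intro conjI ballI)
        show "sorted_wrt (\<sqsubset>) (filter (\<lambda>y. y \<sqsubset> x) xs)"
          "sorted_wrt (\<sqsubset>) (x # filter (\<lambda>y. x \<sqsubset> y) xs)"
          using xs(1) by (simp_all add: chain_def sorted_wrt_filter)
        fix y z assume "y \<in> set (filter (\<lambda>y. y \<sqsubset> x) xs)" "z \<in> set (x # filter (\<lambda>y. x \<sqsubset> y) xs)"
        then show "y \<sqsubset> z"
          using lt_trans[of y x z] insert.prems xs(2) by auto
      qed
    qed
    ultimately show ?case by blast
  qed
  then obtain xs where "chain xs" "set xs = A"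
    by blast
  then show ?thesis
    using that[of xs] distinct_card[OF chain_distinct[of xs]] by simp
qed

text \<open>Setwise information becomes pointwise: the image of an increasing enumeration is
  increasing, and such an enumeration is unique.\<close>

lemma chain_image_aut:
  assumes "hg_aut M E g" "chain xs" "chain ys" "g ` set xs = set ys"
  shows "map g xs = ys"
  using assms(4) by (intro chain_unique[OF chain_map_aut[OF assms(1,2)] assms(3)]) simp

text \<open>The isomorphism \<open>f\<close> may ignore the order; the automorphism obtained from it
  cannot.\<close>

lemma chain_conjugate:
  assumes xs: "chain xs" and ys: "chain ys"
    and len: "length xs = length ys" "length ys \<le> 5"
    and iso: "induced_iso E (set xs) (set ys) f"
  obtains g where "hg_aut M E g" "map g xs = ys"
proof -
  obtain g where "hg_aut M E g" "g ` set xs = set ys"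
  proof (rule set_homogeneousE[OF hom _ _ _ _ _ _ iso])
    show "set xs \<subseteq> M" "set ys \<subseteq> M"
      using xs ys by (auto simp: chain_def)
    show "card (set xs) = card (set ys)" "card (set ys) \<le> 5"
      using xs ys len by (auto simp: distinct_card chain_distinct)
  qed auto
  then show ?thesis
    using that[of g] chain_image_aut[OF _ xs ys] by blast
qed

lemma chain3_conjugate:
  assumes "chain [a, b, c]" "chain [a', b', c']"
  obtains g where "hg_aut M E g" "g a = a'" "g b = b'" "g c = c'"
proof -
  obtain g where g: "hg_aut M E g" "g ` set [a, b, c] = set [a', b', c']"
  proof (rule small_sets_conjugate[OF hyp hom])
    show "set [a, b, c] \<subseteq> M" "set [a', b', c'] \<subseteq> M"
      using assms by (auto simp: chain_def)
    show "card (set [a, b, c]) = card (set [a', b', c'])" "card (set [a', b', c']) \<le> 3"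
      using assms[THEN chain_distinct, THEN distinct_card] by simp_all
  qed auto
  have "map g [a, b, c] = [a', b', c']"
    using chain_image_aut g assms by blast
  then show ?thesis
    using that g by simp
qed

text \<open>The isomorphism type of a 4-set is just whether it is an edge.\<close>

lemma chain4_conjugate:
  assumes xs: "chain [a, b, c, d]" and ys: "chain [a', b', c', d']"
    and E: "{a, b, c, d} \<in> E \<longleftrightarrow> {a', b', c', d'} \<in> E"
  obtains g where "hg_aut M E g" "g a = a'" "g b = b'" "g c = c'" "g d = d'"
proof -
  let ?U = "set [a, b, c, d]" and ?V = "set [a', b', c', d']"
  have card: "card ?U = 4" "card ?V = 4"
    using assms(1,2)[THEN chain_distinct, THEN distinct_card] by simp_all
  then obtain f where f: "bij_betw f ?U ?V"
    using finite_same_card_bij[of ?U ?V] by auto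
  have "induced_iso E ?U ?V f"
  proof (rule induced_isoI[OF hyp f])
    fix e assume "e \<subseteq> ?U" "card e = 4"
    then have "e = ?U"
      using card by (intro card_subset_eq) auto
    then show "e \<in> E \<longleftrightarrow> f ` e \<in> E"
      using f E by (auto simp: bij_betw_def)
  qed
  then obtain g where "hg_aut M E g" "map g [a, b, c, d] = [a', b', c', d']"
    by (rule chain_conjugate[OF xs ys, rotated 2]) simp_all
  then show ?thesis
    using that by simp
qed

section \<open>Extension of triples by one point\<close>

lemma ex_chain4:
  obtains a b c d where "chain [a, b, c, d]" "{a, b, c, d} \<in> E \<longleftrightarrow> k"
proof -
  obtain e where e: "e \<subseteq> M" "card e = 4" "e \<in> E \<longleftrightarrow> k"
    using edge nonedge by (cases k) auto
  then have "finite e"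
    by (simp add: card_ge_0_finite)
  then obtain xs where xs: "chain xs" "set xs = e" "length xs = 4"
    using ex_chain[OF _ e(1)] e(2) by auto
  then obtain a b c d where "xs = [a, b, c, d]"
    by (auto simp: length_Suc_conv numeral_eq_Suc)
  then show ?thesis
    using that xs e by auto
qed

text \<open>Delete the point in the desired position from a 4-chain of the prescribed kind and move
  the remaining triple onto \<open>a\<close>, \<open>b\<close>, \<open>c\<close>.\<close>

lemma extend_triple:
  assumes abc: "chain [a, b, c]"
  shows "\<exists>x. chain [x, a, b, c] \<and> ({x, a, b, c} \<in> E \<longleftrightarrow> k)"
    and "\<exists>x. chain [a, x, b, c] \<and> ({a, x, b, c} \<in> E \<longleftrightarrow> k)"
    and "\<exists>x. chain [a, b, x, c] \<and> ({a, b, x, c} \<in> E \<longleftrightarrow> k)"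
    and "\<exists>x. chain [a, b, c, x] \<and> ({a, b, c, x} \<in> E \<longleftrightarrow> k)"
proof -
  obtain w1 w2 w3 w4 where w: "chain [w1, w2, w3, w4]" and k: "{w1, w2, w3, w4} \<in> E \<longleftrightarrow> k"
    by (rule ex_chain4)
  have image: "chain [g w1, g w2, g w3, g w4]" "{g w1, g w2, g w3, g w4} \<in> E \<longleftrightarrow> k"
    if "hg_aut M E g" for g
    using chain_map_aut[OF that w] hg_aut_edge[OF that, of "{w1, w2, w3, w4}"] w k by simp_all
  have "chain [w2, w3, w4]" using w by simp
  then obtain g where g: "hg_aut M E g" "g w2 = a" "g w3 = b" "g w4 = c"
    using chain3_conjugate abc by blast
  show "\<exists>x. chain [x, a, b, c] \<and> ({x, a, b, c} \<in> E \<longleftrightarrow> k)"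
    using image[OF g(1)] unfolding g(2-4) by blast
  have "chain [w1, w3, w4]" using w by simp
  then obtain g where g: "hg_aut M E g" "g w1 = a" "g w3 = b" "g w4 = c"
    using chain3_conjugate abc by blast
  show "\<exists>x. chain [a, x, b, c] \<and> ({a, x, b, c} \<in> E \<longleftrightarrow> k)"
    using image[OF g(1)] unfolding g(2-4) by blast
  have "chain [w1, w2, w4]" using w by simp
  then obtain g where g: "hg_aut M E g" "g w1 = a" "g w2 = b" "g w4 = c"
    using chain3_conjugate abc by blast
  show "\<exists>x. chain [a, b, x, c] \<and> ({a, b, x, c} \<in> E \<longleftrightarrow> k)"
    using image[OF g(1)] unfolding g(2-4) by blast
  have "chain [w1, w2, w3]" using w by simp
  then obtain g where g: "hg_aut M E g" "g w1 = a" "g w2 = b" "g w3 = c"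
    using chain3_conjugate abc by blast
  show "\<exists>x. chain [a, b, c, x] \<and> ({a, b, c, x} \<in> E \<longleftrightarrow> k)"
    using image[OF g(1)] unfolding g(2-4) by blast
qed

section \<open>Patterns that occur\<close>

definition realized :: "pattern \<Rightarrow> bool" where
  "realized p \<longleftrightarrow> (\<exists>x1 x2 x3 x4 x5. chain [x1, x2, x3, x4, x5] \<and>
     p = ({x2, x3, x4, x5} \<in> E, {x1, x3, x4, x5} \<in> E, {x1, x2, x4, x5} \<in> E,
          {x1, x2, x3, x5} \<in> E, {x1, x2, x3, x4} \<in> E))"

lemma realizedI:
  assumes "chain [x1, x2, x3, x4, x5]"
    "{x2, x3, x4, x5} \<in> E \<longleftrightarrow> p1" "{x1, x3, x4, x5} \<in> E \<longleftrightarrow> p2" "{x1, x2, x4, x5} \<in> E \<longleftrightarrow> p3"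
    "{x1, x2, x3, x5} \<in> E \<longleftrightarrow> p4" "{x1, x2, x3, x4} \<in> E \<longleftrightarrow> p5"
  shows "realized (p1, p2, p3, p4, p5)"
  using assms unfolding realized_def by blast

text \<open>Adding points independently in two different gaps of a triple yields any two prescribed
  values, and the order of the two new points is forced.\<close>

lemma realized_separating:
  shows "\<exists>b d e. realized (x, b, y, d, e)"
    and "\<exists>b c e. realized (x, b, c, y, e)"
    and "\<exists>b c d. realized (x, b, c, d, y)"
    and "\<exists>a c e. realized (a, x, c, y, e)"
    and "\<exists>a c d. realized (a, x, c, d, y)"
    and "\<exists>a b d. realized (a, b, x, d, y)"
proof -
  obtain a b c d where "chain [a, b, c, d]"
    by (rule ex_chain4[of True])
  then have T: "chain [a, b, c]" and M: "a \<in> M" "b \<in> M" "c \<in> M"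
    by auto
  \<comment> \<open>Indices name the gap. Deleting the new point \<open>u\<close> leaves the triple
    with \<open>v\<close>, so the value \<open>x\<close> chosen for \<open>v\<close> appears at the
    position of \<open>u\<close>, and \<open>y\<close> at that of \<open>v\<close>.\<close>
  obtain u1 where u1: "chain [u1, a, b, c]" "{u1, a, b, c} \<in> E \<longleftrightarrow> y"
    using extend_triple(1)[OF T] by blast
  obtain u2 where u2: "chain [a, u2, b, c]" "{a, u2, b, c} \<in> E \<longleftrightarrow> y"
    using extend_triple(2)[OF T] by blast
  obtain u3 where u3: "chain [a, b, u3, c]" "{a, b, u3, c} \<in> E \<longleftrightarrow> y"
    using extend_triple(3)[OF T] by blast
  obtain v2 where v2: "chain [a, v2, b, c]" "{a, v2, b, c} \<in> E \<longleftrightarrow> x"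
    using extend_triple(2)[OF T] by blast
  obtain v3 where v3: "chain [a, b, v3, c]" "{a, b, v3, c} \<in> E \<longleftrightarrow> x"
    using extend_triple(3)[OF T] by blast
  obtain v4 where v4: "chain [a, b, c, v4]" "{a, b, c, v4} \<in> E \<longleftrightarrow> x"
    using extend_triple(4)[OF T] by blast
  have "chain [u1, a, v2, b, c]"
    using u1(1) v2(1) M by (auto intro: lt_trans)
  then show "\<exists>b d e. realized (x, b, y, d, e)"
    using realizedI[of u1 a v2 b c] u1(2) v2(2) by blast
  have "chain [u1, a, b, v3, c]"
    using u1(1) v3(1) M by (auto intro: lt_trans)
  then show "\<exists>b c e. realized (x, b, c, y, e)"
    using realizedI[of u1 a b v3 c] u1(2) v3(2) by blast
  have "chain [u1, a, b, c, v4]"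
    using u1(1) v4(1) M by (auto intro: lt_trans)
  then show "\<exists>b c d. realized (x, b, c, d, y)"
    using realizedI[of u1 a b c v4] u1(2) v4(2) by blast
  have "chain [a, u2, b, v3, c]"
    using u2(1) v3(1) M by (auto intro: lt_trans)
  then show "\<exists>a c e. realized (a, x, c, y, e)"
    using realizedI[of a u2 b v3 c] u2(2) v3(2) by blast
  have "chain [a, u2, b, c, v4]"
    using u2(1) v4(1) M by (auto intro: lt_trans)
  then show "\<exists>a c d. realized (a, x, c, d, y)"
    using realizedI[of a u2 b c v4] u2(2) v4(2) by blast
  have "chain [a, b, u3, c, v4]"
    using u3(1) v4(1) M by (auto intro: lt_trans)
  then show "\<exists>a b d. realized (a, b, x, d, y)"
    using realizedI[of a b u3 c v4] u3(2) v4(2) by blast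
qed

text \<open>The isomorphism type of a five-element set is the number of its points whose deletion leaves
  an edge, whereas automorphisms respect the order and hence the positions of these points.\<close>

lemma realized_unique:
  assumes "realized p" "realized q" "weight p = weight q"
  shows "p = q"
proof -
  obtain x1 x2 x3 x4 x5 where x: "chain [x1, x2, x3, x4, x5]" and
    p: "p = ({x2, x3, x4, x5} \<in> E, {x1, x3, x4, x5} \<in> E, {x1, x2, x4, x5} \<in> E,
             {x1, x2, x3, x5} \<in> E, {x1, x2, x3, x4} \<in> E)"
    using assms(1) unfolding realized_def by blast
  obtain y1 y2 y3 y4 y5 where y: "chain [y1, y2, y3, y4, y5]" and
    q: "q = ({y2, y3, y4, y5} \<in> E, {y1, y3, y4, y5} \<in> E, {y1, y2, y4, y5} \<in> E,
             {y1, y2, y3, y5} \<in> E, {y1, y2, y3, y4} \<in> E)"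
    using assms(2) unfolding realized_def by blast
  let ?U = "set [x1, x2, x3, x4, x5]" and ?V = "set [y1, y2, y3, y4, y5]"
  define D where "D W = {w \<in> W. W - {w} \<in> E}" for W
  have card_D: "card (D (set [z1, z2, z3, z4, z5])) =
      weight ({z2, z3, z4, z5} \<in> E, {z1, z3, z4, z5} \<in> E, {z1, z2, z4, z5} \<in> E,
              {z1, z2, z3, z5} \<in> E, {z1, z2, z3, z4} \<in> E)"
    if "chain [z1, z2, z3, z4, z5]" for z1 z2 z3 z4 z5
  proof -
    let ?zs = "[z1, z2, z3, z4, z5]"
    have dist: "distinct ?zs"
      using that by (rule chain_distinct)
    then have del: "set ?zs - {z1} = {z2, z3, z4, z5}" "set ?zs - {z2} = {z1, z3, z4, z5}"
      "set ?zs - {z3} = {z1, z2, z4, z5}" "set ?zs - {z4} = {z1, z2, z3, z5}"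
      "set ?zs - {z5} = {z1, z2, z3, z4}"
      by auto
    have "D (set ?zs) = set (filter (\<lambda>z. set ?zs - {z} \<in> E) ?zs)"
      unfolding D_def by (simp only: set_filter)
    then have "card (D (set ?zs)) = length (filter (\<lambda>z. set ?zs - {z} \<in> E) ?zs)"
      by (simp only: distinct_card[OF distinct_filter[OF dist]])
    also have "\<dots> = weight (set ?zs - {z1} \<in> E, set ?zs - {z2} \<in> E, set ?zs - {z3} \<in> E,
        set ?zs - {z4} \<in> E, set ?zs - {z5} \<in> E)"
      unfolding weight_def by (simp del: list.set)
    finally show ?thesis
      by (simp only: del)
  qed
  have card: "card ?U = 5" "card ?V = 5"
    using x[THEN chain_distinct, THEN distinct_card] y[THEN chain_distinct, THEN distinct_card]
    by simp_all
  have D_sub: "D ?U \<subseteq> ?U" "D ?V \<subseteq> ?V"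
    by (auto simp: D_def)
  have D_eq: "card (D ?U) = card (D ?V)"
    using assms(3) p q card_D[OF x] card_D[OF y] by simp
  obtain f where f: "bij_betw f ?U ?V" and f_D: "\<forall>z\<in>?U. f z \<in> D ?V \<longleftrightarrow> z \<in> D ?U"
    by (rule ex_bij_betw_subset[OF List.finite_set List.finite_set trans[OF card(1) card(2)[symmetric]]
          D_sub D_eq])
  have "induced_iso E ?U ?V f"
  proof (rule induced_isoI[OF hyp f])
    fix e assume e: "e \<subseteq> ?U" "card e = 4"
    \<comment> \<open>A 4-subset is the complement of a point \<open>z\<close>, and membership of
      \<open>z\<close> in \<open>D\<close> decides whether it is an edge.\<close>
    then have "card (?U - e) = 1"
      using card by (simp add: card_Diff_subset finite_subset[OF e(1)] del: list.set)
    then obtain z where "?U - e = {z}"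
      by (auto simp: card_1_singleton_iff)
    then have z: "z \<in> ?U" "e = ?U - {z}"
      using e(1) by blast+
    then have "f ` e = ?V - {f z}"
      using f by (simp add: bij_betw_def inj_on_image_set_diff[of f ?U] del: list.set)
    moreover have "f z \<in> ?V"
      using f z(1) by (rule bij_betw_apply)
    ultimately show "e \<in> E \<longleftrightarrow> f ` e \<in> E"
      using f_D[THEN bspec, OF z(1)] z by (simp only: D_def mem_Collect_eq simp_thms)
  qed
  then obtain g where g: "hg_aut M E g" and "map g [x1, x2, x3, x4, x5] = [y1, y2, y3, y4, y5]"
    by (rule chain_conjugate[OF x y, rotated 2]) simp_all
  then have "y1 = g x1" "y2 = g x2" "y3 = g x3" "y4 = g x4" "y5 = g x5"
    by auto
  moreover have "{g a, g b, g c, g d} \<in> E \<longleftrightarrow> {a, b, c, d} \<in> E"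
    if "a \<in> M" "b \<in> M" "c \<in> M" "d \<in> M" for a b c d
    using hg_aut_edge[OF g, of "{a, b, c, d}"] that by simp
  ultimately show ?thesis
    using x by (simp add: p q)
qed

text \<open>The first chain without its first point and the second without its second point are
  4-chains with the same value \<open>p1\<close>. An automorphism identifies them, and the union is
  a 6-chain.\<close>

lemma realized_amalgamating:
  assumes "realized (p1, p2, p3, p4, p5)" "realized (q1, p1, q3, q4, q5)"
  shows "\<exists>c24 c25 c26 c45 c46 c56.
        realized (q1, p2, c24, c25, c26) \<and> realized (q3, c24, p3, c45, c46) \<and>
        realized (q4, c25, p4, c45, c56) \<and> realized (q5, c26, p5, c46, c56)"
proof -
  obtain u1 u2 u3 u4 u5 where u: "chain [u1, u2, u3, u4, u5]" and
    p: "p1 \<longleftrightarrow> {u2, u3, u4, u5} \<in> E" "p2 \<longleftrightarrow> {u1, u3, u4, u5} \<in> E"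
      "p3 \<longleftrightarrow> {u1, u2, u4, u5} \<in> E" "p4 \<longleftrightarrow> {u1, u2, u3, u5} \<in> E" "p5 \<longleftrightarrow> {u1, u2, u3, u4} \<in> E"
    using assms(1) unfolding realized_def by blast
  \<comment> \<open>Indices are positions in the future 6-chain, whose first point will come from
    \<open>u1\<close>.\<close>
  obtain x2 x3 x4 x5 x6 where v: "chain [x2, x3, x4, x5, x6]" and
    q: "q1 \<longleftrightarrow> {x3, x4, x5, x6} \<in> E" "p1 \<longleftrightarrow> {x2, x4, x5, x6} \<in> E"
      "q3 \<longleftrightarrow> {x2, x3, x5, x6} \<in> E" "q4 \<longleftrightarrow> {x2, x3, x4, x6} \<in> E" "q5 \<longleftrightarrow> {x2, x3, x4, x5} \<in> E"
    using assms(2) unfolding realized_def by blast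
  have "chain [u2, u3, u4, u5]" "chain [x2, x4, x5, x6]"
    "{u2, u3, u4, u5} \<in> E \<longleftrightarrow> {x2, x4, x5, x6} \<in> E"
    using u v p(1) q(2) by auto
  then obtain g where g: "hg_aut M E g" "g u2 = x2" "g u3 = x4" "g u4 = x5" "g u5 = x6"
    by (rule chain4_conjugate)
  define x1 where "x1 = g u1"
  have x: "chain [x1, x2, x4, x5, x6]"
    using chain_map_aut[OF g(1) u] g by (simp add: x1_def)
  have c: "{g a, g b, g c, g d} \<in> E \<longleftrightarrow> {a, b, c, d} \<in> E"
    if "a \<in> M" "b \<in> M" "c \<in> M" "d \<in> M" for a b c d
    using hg_aut_edge[OF g(1), of "{a, b, c, d}"] that by simp
  have p': "p2 \<longleftrightarrow> {x1, x4, x5, x6} \<in> E" "p3 \<longleftrightarrow> {x1, x2, x5, x6} \<in> E"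
      "p4 \<longleftrightarrow> {x1, x2, x4, x6} \<in> E" "p5 \<longleftrightarrow> {x1, x2, x4, x5} \<in> E"
    using u p c[of u1 u3 u4 u5] c[of u1 u2 u4 u5] c[of u1 u2 u3 u5] c[of u1 u2 u3 u4]
    by (simp_all add: g x1_def)
  \<comment> \<open>The two points outside the common 4-set are separated by \<open>x2\<close>, so
    their order is determined and they cannot coincide.\<close>
  have "x1 \<sqsubset> x3"
    using x v lt_trans[of x1 x2 x3] by simp
  then have "chain [x1, x2, x3, x4, x5, x6]"
    using x v by simp
  then have "chain [x1, x3, x4, x5, x6]" "chain [x1, x2, x3, x5, x6]"
    "chain [x1, x2, x3, x4, x6]" "chain [x1, x2, x3, x4, x5]"
    by simp_all
  note this[THEN realizedI]
  from this(1)[OF q(1)[symmetric] p'(1)[symmetric] refl refl refl]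
    this(2)[OF q(3)[symmetric] refl p'(2)[symmetric] refl refl]
    this(3)[OF q(4)[symmetric] refl p'(3)[symmetric] refl refl]
    this(4)[OF q(5)[symmetric] refl p'(4)[symmetric] refl refl]
  show ?thesis
    by blast
qed

lemma inconsistent: False
  by (rule pattern_class_inconsistent[OF realized_unique realized_separating realized_amalgamating])

end

section \<open>The invariant order of a group that is not two-transitive\<close>

text \<open>Of three points other than \<open>w\<close>, two lie on the same side of
  \<open>w\<close>; either orientation between these two completes a transitive triple.\<close>

lemma tournament_transitive_triple:
  assumes M: "infinite M"
    and total: "\<And>x y. \<lbrakk>x \<in> M; y \<in> M; x \<noteq> y\<rbrakk> \<Longrightarrow> lt x y \<or> lt y x"
  obtains (triple) a b c where "a \<in> M" "b \<in> M" "c \<in> M" "distinct [a, b, c]" "lt a b" "lt b c" "lt a c"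
proof -
  obtain A where "A \<subseteq> M" "finite A" "card A = 4"
    using infinite_arbitrarily_large[OF M] by blast
  then obtain xs where "set xs \<subseteq> M" "distinct xs" "length xs = 4"
    by (metis finite_distinct_list distinct_card)
  then obtain w x y z where M: "w \<in> M" "x \<in> M" "y \<in> M" "z \<in> M" and "distinct [w, x, y, z]"
    by (auto simp: length_Suc_conv numeral_eq_Suc)
  then have neq: "w \<noteq> x" "w \<noteq> y" "w \<noteq> z" "x \<noteq> y" "x \<noteq> z" "y \<noteq> z"
    by auto
  have source: thesis
    if "p \<in> M" "q \<in> M" "r \<in> M" "p \<noteq> q" "p \<noteq> r" "q \<noteq> r" "lt p q" "lt p r" for p q r
    using total[of q r] that triple[of p q r] triple[of p r q] by auto
  have sink: thesis
    if "p \<in> M" "q \<in> M" "r \<in> M" "p \<noteq> q" "p \<noteq> r" "q \<noteq> r" "lt q p" "lt r p" for p q r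
    using total[of q r] that triple[of q r p] triple[of r q p] by auto
  show ?thesis
    using total[OF M(1,2) neq(1)] total[OF M(1,3) neq(2)] total[OF M(1,4) neq(3)]
      source[OF M(1,2,3) neq(1,2,4)] source[OF M(1,2,4) neq(1,3,5)] source[OF M(1,3,4) neq(2,3,6)]
      sink[OF M(1,2,3) neq(1,2,4)] sink[OF M(1,2,4) neq(1,3,5)] sink[OF M(1,3,4) neq(2,3,6)]
    by blast
qed

theorem theoremB:
  fixes M :: "'a set" and E :: "'a set set"
  assumes "countable M" and "infinite M"
    and "hypergraph4 M E"
    and "set_homogeneous_upto 5 M E"
  shows "aut_two_transitive M E"
proof (rule ccontr)
  assume contr: "\<not> aut_two_transitive M E"
  note hyp = assms(3) and hom = assms(4)
  obtain x0 y0 u0 v0 where xy: "x0 \<in> M" "y0 \<in> M" "u0 \<in> M" "v0 \<in> M" "x0 \<noteq> y0" "u0 \<noteq> v0"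
    and no: "\<And>g. hg_aut M E g \<Longrightarrow> \<not> (g x0 = u0 \<and> g y0 = v0)"
    using contr unfolding aut_two_transitive_def by blast
  \<comment> \<open>The orbit of \<open>(x0, y0)\<close> on ordered pairs, which misses
    \<open>(u0, v0)\<close>.\<close>
  define lt where "lt a b \<longleftrightarrow> (\<exists>g. hg_aut M E g \<and> g x0 = a \<and> g y0 = b)" for a b
  have total: "lt a b \<or> lt b a" if ab: "a \<in> M" "b \<in> M" "a \<noteq> b" for a b
  proof -
    obtain g where "hg_aut M E g" "g ` {x0, y0} = {a, b}"
      by (rule small_sets_conjugate[OF hyp hom, of "{x0, y0}" "{a, b}"]) (use xy ab in auto)
    then have "g x0 = a \<and> g y0 = b \<or> g x0 = b \<and> g y0 = a"
      by (simp add: doubleton_eq_iff)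
    then show ?thesis
      using \<open>hg_aut M E g\<close> unfolding lt_def by blast
  qed
  have aut: "lt (g a) (g b)" if "hg_aut M E g" "lt a b" for g a b
  proof -
    obtain h where "hg_aut M E h" "h x0 = a" "h y0 = b"
      using \<open>lt a b\<close> unfolding lt_def by blast
    then show ?thesis
      using hg_aut_comp[OF that(1)] unfolding lt_def by (intro exI[of _ "g \<circ> h"]) simp
  qed
  have asym: "\<not> lt b a" if "lt a b" for a b
  proof
    assume "lt b a"
    obtain g h where g: "hg_aut M E g" "g x0 = a" "g y0 = b"
      and h: "hg_aut M E h" "h x0 = b" "h y0 = a"
      using \<open>lt a b\<close> \<open>lt b a\<close> unfolding lt_def by blast
    \<comment> \<open>Swaps \<open>x0\<close> and \<open>y0\<close>. By totality the orbit contains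
      \<open>(v0, u0)\<close>, and composing with the swap would put \<open>(u0, v0)\<close> into it
      as well.\<close>
    define k where "k = inv_into M g \<circ> h"
    have "inj_on g M"
      using g(1) by (simp add: hg_aut_def bij_betw_def)
    then have k: "hg_aut M E k" "k x0 = y0" "k y0 = x0"
      using hg_aut_comp[OF hg_aut_inv_into[OF g(1)] h(1)] xy g h
      by (simp_all add: k_def inv_into_f_eq)
    have "\<not> lt u0 v0"
      using no unfolding lt_def by blast
    then have "lt v0 u0"
      using total[OF xy(3,4,6)] by blast
    then obtain m where m: "hg_aut M E m" "m x0 = v0" "m y0 = u0"
      unfolding lt_def by blast
    then show False
      using no[OF hg_aut_comp[OF m(1) k(1)]] k by simp
  qed
  have trans: "lt p r" if pqr: "p \<in> M" "q \<in> M" "r \<in> M" "lt p q" "lt q r" for p q r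
  proof (rule ccontr)
    assume "\<not> lt p r"
    have neq: "p \<noteq> q" "q \<noteq> r" "p \<noteq> r"
      using asym pqr by blast+
    then have "lt r p"
      using total pqr \<open>\<not> lt p r\<close> by blast
    \<comment> \<open>Otherwise \<open>p\<close>, \<open>q\<close>, \<open>r\<close> form a 3-cycle
      that is conjugate to a transitive triple, but no point of a 3-cycle dominates the other
      two.\<close>
    obtain a b c where abc: "a \<in> M" "b \<in> M" "c \<in> M" "distinct [a, b, c]" "lt a b" "lt b c" "lt a c"
      by (rule tournament_transitive_triple[OF assms(2) total])
    obtain g where g: "hg_aut M E g" "g ` {a, b, c} = {p, q, r}"
      by (rule small_sets_conjugate[OF hyp hom, of "{a, b, c}" "{p, q, r}"])
        (use abc pqr neq in auto)
    have "lt (g a) (g b)" "lt (g a) (g c)" "lt (g b) (g c)"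
      using aut[OF g(1)] abc by blast+
    moreover have "g a \<in> {p, q, r}" "g b \<in> {p, q, r}" "g c \<in> {p, q, r}"
      using g(2) by blast+
    moreover have "\<not> lt p p" "\<not> lt q q" "\<not> lt r r"
      using asym by blast+
    ultimately show False
      using asym[OF pqr(4)] asym[OF pqr(5)] asym[OF \<open>lt r p\<close>] by auto
  qed
  have "\<exists>e\<subseteq>M. card e = 4 \<and> e \<in> E" "\<exists>e\<subseteq>M. card e = 4 \<and> e \<notin> E"
    using trivial_hypergraph_two_transitive[OF hyp] contr by blast+
  then have "ordered_hypergraph M E lt"
  proof (rule ordered_hypergraph.intro[OF hyp hom])
    show "\<not> lt x x" for x
      using asym by blast
    show "lt (g x) (g y)" if "hg_aut M E g" "lt x y" for g x y
      using that by (rule aut)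
  qed (fact trans total)+
  then show False
    by (rule ordered_hypergraph.inconsistent)
qed

end
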